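(* Let $\alpha\in(0,1]$, $A\in C(\mathbb{R},\mathbb{R}^{n\times n})$, $f\in C(\mathbb{R},\mathbb{R}^n)$, and let $X(t)$ be a fundamental matrix of $\mathcal{T}^\alpha x=A(t)x$. Then for $t_0\in\mathbb{R}$ and $x_0\in\mathbb{R}^n$ the general solution of $\mathcal{T}^\alpha x=A(t)x+f(t)$ associated with the initial data $x(t_0)=x_0$ is given by $$x(t)=X(t)X^{-1}(t_0)x_0+X(t)\int_{t_0}^t|s|^{\alpha-1}X^{-1}(s)f(s)\,ds,\qquad t\in\mathbb{R}.$$ In particular, if $A(t)\equiv A$ is a constant real $n\times n$ matrix, then this formula becomes $$x(t)=E_\alpha(A,t)E_\alpha(A,t_0)^{-1}x_0+E_\alpha(A,t)\int_{t_0}^t|s|^{\alpha-1}E_\alpha(A,s)^{-1}f(s)\,ds,\qquad t\in\mathbb{R}.$$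
   Context: For $\alpha\in(0,1]$ the $\alpha$-conformable fractional derivative of a function $g$ is $\mathcal{T}^\alpha g(t):=\lim_{\varepsilon\to0}\frac{g(t+\varepsilon|t|^{1-\alpha})-g(t)}{\varepsilon}$ (so $\mathcal{T}^\alpha g(t)=|t|^{1-\alpha}g'(t)$ for $t\neq0$); at $t=0$, $\mathcal{T}^\alpha g(0):=\lim_{t\to0}\mathcal{T}^\alpha g(t)$ if this limit exists. Solutions are continuous functions satisfying the equation. A fundamental matrix (fundamental solution) of $\mathcal{T}^\alpha x=A(t)x$ is an $n\times n$ matrix function whose columns are $n$ linearly independent solutions on $\mathbb{R}$. For a constant matrix $A$, $E_\alpha(A,t):=\sum_{k=0}^{\infty}\frac{A^kt^{\alpha k}}{\alpha^kk!}$ for $t\ge0$ and $E_\alpha(A,t):=\sum_{k=0}^{\infty}\frac{(-A)^k(-t)^{\alpha k}}{\alpha^kk!}$ for $t\le0$. *)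

theory Defs
  imports "HOL-Analysis.Analysis"
begin

definition conformable_quotient_limit ::
  "real \<Rightarrow> (real \<Rightarrow> 'a::real_normed_vector) \<Rightarrow> 'a \<Rightarrow> real \<Rightarrow> bool" where
  "conformable_quotient_limit \<alpha> g D t \<longleftrightarrow>
     ((\<lambda>\<epsilon>. (g (t + \<epsilon> * \<bar>t\<bar> powr (1 - \<alpha>)) - g t) /\<^sub>R \<epsilon>) \<longlongrightarrow> D) (at 0)"

text \<open>
  The \<open>\<alpha>\<close>-conformable derivative of \<open>g\<close> at \<open>t\<close> exists and equals \<open>D\<close>. At \<open>t = 0\<close> it is the limit
  of the derivatives at the neighbouring points, which must exist; this is the convention for
  \<open>\<alpha> = 1\<close> as well, and the quotient itself is only used for \<open>t \<noteq> 0\<close>.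
\<close>
definition has_conformable_derivative ::
  "real \<Rightarrow> (real \<Rightarrow> 'a::real_normed_vector) \<Rightarrow> 'a \<Rightarrow> real \<Rightarrow> bool" where
  "has_conformable_derivative \<alpha> g D t \<longleftrightarrow>
     (if t = 0
      then \<exists>h. (\<forall>\<^sub>F s in at 0. conformable_quotient_limit \<alpha> g (h s) s) \<and> (h \<longlongrightarrow> D) (at 0)
      else conformable_quotient_limit \<alpha> g D t)"

definition conformable_solution ::
  "real \<Rightarrow> (real \<Rightarrow> 'a::real_normed_vector \<Rightarrow> 'a) \<Rightarrow> (real \<Rightarrow> 'a) \<Rightarrow> bool" where
  "conformable_solution \<alpha> F x \<longleftrightarrow>
     continuous_on UNIV x \<and> (\<forall>t. has_conformable_derivative \<alpha> x (F t (x t)) t)"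

text \<open>The columns are linearly independent as functions on the real line, not just pointwise.\<close>
definition fundamental_matrix ::
  "real \<Rightarrow> (real \<Rightarrow> real^'n^'n) \<Rightarrow> (real \<Rightarrow> real^'n^'n) \<Rightarrow> bool" where
  "fundamental_matrix \<alpha> A X \<longleftrightarrow>
     (\<forall>j. conformable_solution \<alpha> (\<lambda>t y. A t *v y) (\<lambda>t. column j (X t))) \<and>
     (\<forall>c. (\<forall>t. (\<Sum>j\<in>UNIV. c j *\<^sub>R column j (X t)) = 0) \<longrightarrow> (\<forall>j. c j = (0::real)))"

text \<open>The type-class power on \<^typ>\<open>real^'n^'n\<close> is componentwise.\<close>
primrec matrix_power :: "real^'n^'n \<Rightarrow> nat \<Rightarrow> real^'n^'n" where
  "matrix_power A 0 = mat 1"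
| "matrix_power A (Suc k) = A ** matrix_power A k"

text \<open>
  Since \<^term>\<open>0 powr 0 = (0::real)\<close>, the power \<open>t\<close> to the \<open>\<alpha> k\<close> is written as \<open>(t powr \<alpha>) ^ k\<close>, which
  has the intended value \<open>1\<close> for \<open>t = 0\<close>, \<open>k = 0\<close>.
\<close>
definition conformable_exp :: "real \<Rightarrow> real^'n^'n \<Rightarrow> real \<Rightarrow> real^'n^'n" where
  "conformable_exp \<alpha> A t =
     (if 0 \<le> t
      then \<Sum>k. ((t powr \<alpha>) ^ k / (\<alpha> ^ k * fact k)) *\<^sub>R matrix_power A k
      else \<Sum>k. (((- t) powr \<alpha>) ^ k / (\<alpha> ^ k * fact k)) *\<^sub>R matrix_power (- A) k)"

end

theory Submission
  imports Defs
begin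

text \<open>
  Away from \<open>t = 0\<close> the equation is the linear system \<open>x' = |t|\<^sup>\<alpha>\<^sup>-\<^sup>1 (A x + f)\<close>, and for a continuous right-hand
  side the condition at \<open>t = 0\<close> follows from continuity of \<open>x\<close>. The singular weight has the
  continuous antiderivative \<open>\<phi>(t) = sgn t |t|\<^sup>\<alpha> / \<alpha>\<close>, so it is locally integrable, and an energy
  estimate with the factor \<open>exp (\<plusminus> 2 K \<phi>)\<close> gives uniqueness for the homogeneous system, hence
  invertibility of \<open>X t\<close>. Writing \<open>X t *v u t\<close> as a combination of columns yields the
  variation of constants formula, and \<open>E\<^sub>\<alpha>(M, t) = exp (\<phi>(t) M)\<close> is a fundamental matrix.
\<close>

section \<open>Matrix-vector products and inverses\<close>

lemma bounded_bilinear_matrix_vector_mult: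
  "bounded_bilinear ((*v) :: real^'n^'m \<Rightarrow> real^'n \<Rightarrow> real^'m)"
  unfolding bilinear_conv_bounded_bilinear [symmetric] bilinear_def linear_iff
  by (auto simp: matrix_vector_right_distrib matrix_vector_mult_add_rdistrib
      matrix_vector_mult_scaleR scaleR_matrix_vector_assoc)

lemma matrix_inv_both:
  fixes A :: "real^'n^'n"
  assumes "invertible A"
  shows "A ** matrix_inv A = mat 1" "matrix_inv A ** A = mat 1"
proof -
  have "A ** matrix_inv A = mat 1 \<and> matrix_inv A ** A = mat 1"
    using assms unfolding invertible_def matrix_inv_def by (rule someI_ex)
  then show "A ** matrix_inv A = mat 1" "matrix_inv A ** A = mat 1"
    by auto
qed

lemma matrix_inv_mult_vector_eq_iff:
  fixes A :: "real^'n^'n"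
  assumes "invertible A"
  shows "A *v x = b \<longleftrightarrow> x = matrix_inv A *v b"
  using matrix_inv_both [OF assms] by (metis matrix_vector_mul_assoc matrix_vector_mul_lid)

text \<open>By Cramer's rule each component of \<open>matrix_inv (X t) *v b t\<close> is a quotient
  of two determinants, polynomial in continuous entries, and the denominator
  \<open>det (X t)\<close> does not vanish on \<open>S\<close>.\<close>

lemma continuous_on_matrix_inv_mult_vector:
  fixes X :: "'a::topological_space \<Rightarrow> real^'n^'n" and b :: "'a \<Rightarrow> real^'n"
  assumes X: "continuous_on S X" and b: "continuous_on S b"
    and inv: "\<And>t. t \<in> S \<Longrightarrow> invertible (X t)"
  shows "continuous_on S (\<lambda>t. matrix_inv (X t) *v b t)"
proof -
  have det: "det (X t) \<noteq> 0" if "t \<in> S" for t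
    using inv [OF that] invertible_det_nz by blast
  have eq: "matrix_inv (X t) *v b t =
      (\<chi> k. det (\<chi> i j. if j = k then b t $ i else X t $ i $ j) / det (X t))" if "t \<in> S" for t
    using matrix_inv_mult_vector_eq_iff [OF inv [OF that], THEN iffD2, OF refl]
    by (simp only: cramer [OF det [OF that]])
  have entry: "continuous_on S (\<lambda>t. if j = k then b t $ i else X t $ i $ j)" for i j k
    by (cases "j = k") (auto intro!: continuous_intros X b)
  have "continuous_on S
      (\<lambda>t. \<chi> k. det (\<chi> i j. if j = k then b t $ i else X t $ i $ j) / det (X t))"
    using det unfolding det_def
    by (intro continuous_intros continuous_on_vec_lambda) (simp_all add: entry X)
  then show ?thesis
    by (simp add: eq cong: continuous_on_cong)
qed

section \<open>The conformable equation as a weighted ordinary differential equation\<close>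

text \<open>For fixed \<open>t\<close>, the increment \<open>\<epsilon> * c\<close> with
  \<open>c = \<bar>t\<bar> powr (1 - \<alpha>)\<close> is a nonzero multiple of
  \<open>\<epsilon>\<close>, so the conformable quotient is \<open>c\<close> times the ordinary
  difference quotient at that increment.\<close>

lemma conformable_quotient_limit_iff:
  assumes "t \<noteq> 0"
  shows "conformable_quotient_limit \<alpha> g D t \<longleftrightarrow>
    (g has_vector_derivative (\<bar>t\<bar> powr (\<alpha> - 1) *\<^sub>R D)) (at t)"
proof -
  define c where "c = \<bar>t\<bar> powr (1 - \<alpha>)"
  have c: "c > 0" "\<bar>t\<bar> powr (\<alpha> - 1) = inverse c"
    using assms by (auto simp: c_def simp flip: powr_minus)
  \<comment> \<open>A nonzero scaling preserves the punctured neighbourhoods of 0. Using it with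
    \<open>c\<close> and with \<open>inverse c\<close> transfers the limit in both
    directions.\<close>
  have scale: "filterlim (\<lambda>\<epsilon>::real. \<epsilon> * k) (at 0) (at 0)" if "k \<noteq> 0" for k
  proof -
    have "((\<lambda>\<epsilon>. \<epsilon> * k) \<longlongrightarrow> 0 * k) (at 0)"
      by (intro tendsto_intros)
    then show ?thesis
      using that by (auto simp: filterlim_at eventually_at intro: exI [of _ 1])
  qed
  let ?q = "\<lambda>h. (g (t + h) - g t) /\<^sub>R h"
  have "conformable_quotient_limit \<alpha> g D t \<longleftrightarrow> ((\<lambda>\<epsilon>. ?q (\<epsilon> * c)) \<longlongrightarrow> inverse c *\<^sub>R D) (at 0)"
  proof
    assume "conformable_quotient_limit \<alpha> g D t"
    then have "((\<lambda>\<epsilon>. inverse c *\<^sub>R ((g (t + \<epsilon> * c) - g t) /\<^sub>R \<epsilon>)) \<longlongrightarrow> inverse c *\<^sub>R D) (at 0)"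
      unfolding conformable_quotient_limit_def c_def by (intro tendsto_intros)
    then show "((\<lambda>\<epsilon>. ?q (\<epsilon> * c)) \<longlongrightarrow> inverse c *\<^sub>R D) (at 0)"
      by (simp add: mult.commute)
  next
    assume "((\<lambda>\<epsilon>. ?q (\<epsilon> * c)) \<longlongrightarrow> inverse c *\<^sub>R D) (at 0)"
    then have "((\<lambda>\<epsilon>. c *\<^sub>R ?q (\<epsilon> * c)) \<longlongrightarrow> c *\<^sub>R inverse c *\<^sub>R D) (at 0)"
      by (rule tendsto_scaleR [OF tendsto_const])
    then show "conformable_quotient_limit \<alpha> g D t"
      using c(1) by (simp add: conformable_quotient_limit_def field_simps flip: c_def)
  qed
  also have "\<dots> \<longleftrightarrow> (?q \<longlongrightarrow> inverse c *\<^sub>R D) (at 0)"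
  proof
    assume "((\<lambda>\<epsilon>. ?q (\<epsilon> * c)) \<longlongrightarrow> inverse c *\<^sub>R D) (at 0)"
    from filterlim_compose [OF this scale [of "inverse c"]] c
    show "(?q \<longlongrightarrow> inverse c *\<^sub>R D) (at 0)"
      by (simp add: mult.assoc)
  next
    assume "(?q \<longlongrightarrow> inverse c *\<^sub>R D) (at 0)"
    from filterlim_compose [OF this scale [of c]] c
    show "((\<lambda>\<epsilon>. ?q (\<epsilon> * c)) \<longlongrightarrow> inverse c *\<^sub>R D) (at 0)"
      by simp
  qed
  also have "\<dots> \<longleftrightarrow> ((\<lambda>h. norm (?q h - inverse c *\<^sub>R D)) \<longlongrightarrow> 0) (at 0)"
    by (simp add: tendsto_norm_zero_iff LIM_zero_iff)
  also have "\<dots> \<longleftrightarrow> ((\<lambda>h. norm (g (t + h) - g t - h *\<^sub>R inverse c *\<^sub>R D) / norm h) \<longlongrightarrow> 0) (at 0)"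
  proof (rule filterlim_cong [OF refl refl], unfold eventually_at, intro exI conjI ballI impI)
    fix h :: real
    assume h: "h \<noteq> 0 \<and> dist h 0 < 1"
    have "?q h - inverse c *\<^sub>R D = (g (t + h) - g t - h *\<^sub>R inverse c *\<^sub>R D) /\<^sub>R h"
      using h by (simp add: scaleR_diff_right)
    then show "norm (?q h - inverse c *\<^sub>R D)
        = norm (g (t + h) - g t - h *\<^sub>R inverse c *\<^sub>R D) / norm h"
      by (simp add: divide_inverse mult.commute)
  qed simp
  finally show ?thesis
    by (simp only: has_vector_derivative_def has_derivative_at c(2) bounded_linear_scaleR_left
        simp_thms)
qed

text \<open>The witness for the derivative at 0 is the right-hand side along \<open>x\<close>: the
  equation makes it the derivative at every \<open>s \<noteq> 0\<close>, and by continuity it tends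
  to its own value at 0.\<close>

lemma conformable_solution_iff:
  assumes F: "continuous_on UNIV x \<Longrightarrow> continuous_on UNIV (\<lambda>t. F t (x t))"
  shows "conformable_solution \<alpha> F x \<longleftrightarrow> continuous_on UNIV x \<and>
    (\<forall>t. t \<noteq> 0 \<longrightarrow> (x has_vector_derivative (\<bar>t\<bar> powr (\<alpha> - 1) *\<^sub>R F t (x t))) (at t))"
proof -
  have "has_conformable_derivative \<alpha> x (F 0 (x 0)) 0"
    if x: "continuous_on UNIV x" and D: "\<forall>t. t \<noteq> 0 \<longrightarrow> conformable_quotient_limit \<alpha> x (F t (x t)) t"
    unfolding has_conformable_derivative_def if_P [OF refl]
  proof (intro exI conjI)
    show "\<forall>\<^sub>F s in at 0. conformable_quotient_limit \<alpha> x (F s (x s)) s"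
      using D by (auto simp: eventually_at intro: exI [of _ 1])
    show "((\<lambda>s. F s (x s)) \<longlongrightarrow> F 0 (x 0)) (at 0)"
      using F [OF x] by (simp add: continuous_on_def)
  qed
  then have "conformable_solution \<alpha> F x \<longleftrightarrow> continuous_on UNIV x \<and>
      (\<forall>t. t \<noteq> 0 \<longrightarrow> conformable_quotient_limit \<alpha> x (F t (x t)) t)"
    unfolding conformable_solution_def by (metis has_conformable_derivative_def)
  then show ?thesis
    by (simp add: conformable_quotient_limit_iff)
qed

section \<open>The antiderivative of the weight and weighted integrals\<close>

text \<open>The change of time that absorbs the weight: for \<open>t \<noteq> 0\<close> the
  homogeneous equation in this variable is an ordinary linear system without weight.\<close>

definition conformable_time :: "real \<Rightarrow> real \<Rightarrow> real" where
  "conformable_time \<alpha> t = sgn t * \<bar>t\<bar> powr \<alpha> / \<alpha>"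

lemma continuous_on_conformable_time:
  assumes "0 < \<alpha>"
  shows "continuous_on S (conformable_time \<alpha>)"
proof -
  \<comment> \<open>Splitting into positive and negative parts leaves powers of nonnegative bases
    with a positive exponent, which are continuous even where the base is 0.\<close>
  have "conformable_time \<alpha> = (\<lambda>t. (max t 0 powr \<alpha> - max (- t) 0 powr \<alpha>) / \<alpha>)"
    by (auto simp: fun_eq_iff conformable_time_def sgn_if max_def)
  then show ?thesis
    using assms by (auto intro!: continuous_intros continuous_on_powr')
qed

lemma conformable_time_has_vector_derivative:
  assumes "0 < \<alpha>" "t \<noteq> 0"
  shows "(conformable_time \<alpha> has_vector_derivative \<bar>t\<bar> powr (\<alpha> - 1)) (at t)"
proof (cases "t > 0")
  case True
  have "((\<lambda>t. t powr \<alpha> / \<alpha>) has_real_derivative \<bar>t\<bar> powr (\<alpha> - 1)) (at t)"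
    using True assms by (auto intro!: derivative_eq_intros)
  then show ?thesis
    unfolding has_real_derivative_iff_has_vector_derivative
    by (rule has_vector_derivative_transform_within_open [of _ _ _ "{0<..}"])
      (use True in \<open>auto simp: conformable_time_def\<close>)
next
  case False
  have "((\<lambda>t. - ((- t) powr \<alpha> / \<alpha>)) has_real_derivative \<bar>t\<bar> powr (\<alpha> - 1)) (at t)"
    using False assms by (auto intro!: derivative_eq_intros)
  then show ?thesis
    unfolding has_real_derivative_iff_has_vector_derivative
    by (rule has_vector_derivative_transform_within_open [of _ _ _ "{..<0}"])
      (use False assms in \<open>auto simp: conformable_time_def\<close>)
qed

text \<open>The weight has a continuous antiderivative, with 0 as the only exceptional point, so it
  is gauge integrable; being nonnegative, it is absolutely integrable, and multiplying by the
  bounded measurable \<open>g\<close> preserves this.\<close>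

lemma weight_set_integrable:
  fixes g :: "real \<Rightarrow> 'a::euclidean_space"
  assumes "0 < \<alpha>" and g: "continuous_on UNIV g"
  shows "set_integrable lborel {a..b} (\<lambda>s. \<bar>s\<bar> powr (\<alpha> - 1) *\<^sub>R g s)"
proof (cases "a \<le> b")
  case True
  have "((\<lambda>s. \<bar>s\<bar> powr (\<alpha> - 1)) has_integral conformable_time \<alpha> b - conformable_time \<alpha> a) {a..b}"
    using assms True
    by (intro fundamental_theorem_of_calculus_interior_strong [of "{0}"]
        conformable_time_has_vector_derivative continuous_on_conformable_time) auto
  then have w: "(\<lambda>s. \<bar>s\<bar> powr (\<alpha> - 1)) absolutely_integrable_on {a..b}"
    by (intro nonnegative_absolutely_integrable_1) auto
  have "bilinear (\<lambda>(x::'a) c. c *\<^sub>R x)"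
    by (simp add: bilinear_def linear_iff scaleR_add_left scaleR_add_right)
  moreover have "g \<in> borel_measurable (lebesgue_on {a..b})"
    using g by (intro continuous_imp_measurable_on_sets_lebesgue continuous_on_subset [OF g]) auto
  moreover have "bounded (g ` {a..b})"
    by (intro compact_imp_bounded compact_continuous_image continuous_on_subset [OF g]) auto
  ultimately have "(\<lambda>s. \<bar>s\<bar> powr (\<alpha> - 1) *\<^sub>R g s) absolutely_integrable_on {a..b}"
    using w by (intro absolutely_integrable_bounded_measurable_product [of "\<lambda>x c. c *\<^sub>R x"]) auto
  \<comment> \<open>Absolute integrability refers to the completion of \<open>lborel\<close>; Borel
    measurability of the integrand brings integrability down to \<open>lborel\<close>
    itself.\<close>
  moreover have "(\<lambda>s. indicator {a..b} s *\<^sub>R \<bar>s\<bar> powr (\<alpha> - 1) *\<^sub>R g s) \<in> borel_measurable lborel"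
    using borel_measurable_continuous_onI [OF g] by measurable
  ultimately show ?thesis
    unfolding set_integrable_def by (subst (asm) integrable_completion) auto
qed (simp add: set_integrable_def)

lemma weight_interval_integrable:
  fixes g :: "real \<Rightarrow> 'a::euclidean_space"
  assumes "0 < \<alpha>" "continuous_on UNIV g"
  shows "interval_lebesgue_integrable lborel (ereal a) (ereal b) (\<lambda>s. \<bar>s\<bar> powr (\<alpha> - 1) *\<^sub>R g s)"
proof -
  have "set_integrable lborel (einterval (ereal c) (ereal d)) (\<lambda>s. \<bar>s\<bar> powr (\<alpha> - 1) *\<^sub>R g s)" for c d :: real
    by (rule set_integrable_subset [OF weight_set_integrable [OF assms, of c d]]) auto
  then show ?thesis
    by (simp add: interval_lebesgue_integrable_def del: einterval_eq)
qed

text \<open>Continuity of the indefinite integral needs only integrability and so holds across 0;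
  differentiability uses continuity of the integrand, available where
  \<open>t \<noteq> 0\<close>.\<close>

lemma weight_interval_integral:
  fixes g :: "real \<Rightarrow> 'a::euclidean_space" and a t :: real
  assumes \<alpha>: "0 < \<alpha>" and g: "continuous_on UNIV g"
  defines "U \<equiv> \<lambda>t. LBINT s=ereal a..ereal t. \<bar>s\<bar> powr (\<alpha> - 1) *\<^sub>R g s"
  shows "continuous_on UNIV U"
    and "t \<noteq> 0 \<Longrightarrow> (U has_vector_derivative (\<bar>t\<bar> powr (\<alpha> - 1) *\<^sub>R g t)) (at t)"
proof -
  define G where "G = (\<lambda>s. \<bar>s\<bar> powr (\<alpha> - 1) *\<^sub>R g s)"
  have int: "G integrable_on {c..d}" for c d
    using weight_set_integrable [OF \<alpha> g, of c d] set_borel_integral_eq_integral(1)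
    unfolding G_def by blast
  have contG: "isCont G s" if "s \<noteq> 0" for s
    using that g unfolding G_def
    by (intro continuous_intros) (auto simp: continuous_on_eq_continuous_at)
  \<comment> \<open>Moving the base point to some \<open>c\<close> left of \<open>u\<close> turns
    the oriented integral into an unoriented one plus a constant, whatever the order of
    \<open>a\<close> and \<open>u\<close>.\<close>
  have U: "U u = integral {c..u} G + (LBINT s=ereal a..ereal c. G s)" if "c \<le> u" for u c
  proof -
    have "(LBINT s=ereal a..ereal c. G s) + (LBINT s=ereal c..ereal u. G s) = U u"
      unfolding U_def G_def
      by (rule interval_integral_sum)
        (simp add: weight_interval_integrable [OF \<alpha> g] flip: ereal_min ereal_max)
    then show ?thesis
      using interval_integral_eq_integral [OF that weight_set_integrable [OF \<alpha> g]]
      unfolding G_def by (simp add: add.commute)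
  qed
  have "isCont U u" for u
  proof -
    have "continuous_on {u-1..u+1} (\<lambda>v. integral {u-1..v} G + (LBINT s=ereal a..ereal (u-1). G s))"
      by (intro continuous_intros indefinite_integral_continuous_1 int)
    then have "continuous_on {u-1..u+1} U"
      by (rule continuous_on_eq) (use U [of "u-1"] in auto)
    then show ?thesis
      by (rule continuous_on_interior) (simp add: interior_atLeastAtMost_real)
  qed
  then show "continuous_on UNIV U"
    by (simp add: continuous_at_imp_continuous_on)
  show "(U has_vector_derivative (\<bar>t\<bar> powr (\<alpha> - 1) *\<^sub>R g t)) (at t)" if "t \<noteq> 0"
  proof -
    have "((\<lambda>v. integral {t-1..v} G) has_vector_derivative G t) (at t within {t-1..t+1} - {})"
      using contG [OF that]
      by (intro integral_has_vector_derivative_continuous_at int)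
        (auto simp: continuous_at_imp_continuous_at_within)
    then have "((\<lambda>v. integral {t-1..v} G) has_vector_derivative G t) (at t)"
      by (simp only: Diff_empty at_within_Icc_at [of "t - 1" t "t + 1", simplified])
    then have "((\<lambda>v. integral {t-1..v} G + (LBINT s=ereal a..ereal (t-1). G s))
        has_vector_derivative G t) (at t)"
      by (subst has_vector_derivative_add_const)
    then have "(U has_vector_derivative G t) (at t)"
      by (rule has_vector_derivative_transform_within_open [of _ _ _ "{t-1<..<t+1}"])
        (use U [of "t-1"] in auto)
    then show ?thesis
      by (simp add: G_def)
  qed
qed

section \<open>Uniqueness for the homogeneous system\<close>

lemma matrix_vector_bound_on_compact:
  fixes A :: "'a::topological_space \<Rightarrow> real^'n^'m"
  assumes "compact S" "continuous_on S A"
  obtains K where "0 \<le> K" "\<And>t x. t \<in> S \<Longrightarrow> norm (A t *v x) \<le> K * norm x"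
proof -
  obtain B where B: "B > 0" "\<And>(M::real^'n^'m) x. norm (M *v x) \<le> norm M * norm x * B"
    using bounded_bilinear.pos_bounded [OF bounded_bilinear_matrix_vector_mult] by blast
  have "bounded (A ` S)"
    using assms compact_continuous_image compact_imp_bounded by blast
  then obtain C where C: "C > 0" "\<And>t. t \<in> S \<Longrightarrow> norm (A t) \<le> C"
    unfolding bounded_pos by auto
  show thesis
  proof
    show "0 \<le> C * B"
      using B C by simp
    show "norm (A t *v x) \<le> C * B * norm x" if "t \<in> S" for t x
    proof -
      have "norm (A t *v x) \<le> norm (A t) * norm x * B"
        by (rule B(2))
      also have "\<dots> \<le> C * norm x * B"
        using B(1) C(2) [OF that] by (intro mult_right_mono) auto
      finally show ?thesis
        by (simp add: mult_ac)
    qed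
  qed
qed

text \<open>
  If \<open>|A| \<le> K\<close> between \<open>a\<close> and \<open>t\<close>, then \<open>exp (-2 K \<phi>) |x|\<^sup>2\<close> decreases to the right of
  \<open>a\<close> and \<open>exp (2 K \<phi>) |x|\<^sup>2\<close> increases to the left of it, \<open>\<phi>\<close> being the conformable time.
\<close>
lemma homogeneous_solution_unique:
  fixes A :: "real \<Rightarrow> real^'n^'n"
  assumes \<alpha>: "0 < \<alpha>" and A: "continuous_on UNIV A" and x: "continuous_on UNIV x"
    and deriv: "\<And>t. t \<noteq> 0 \<Longrightarrow>
      (x has_vector_derivative (\<bar>t\<bar> powr (\<alpha> - 1) *\<^sub>R (A t *v x t))) (at t)"
    and zero: "x a = 0"
  shows "x t = 0"
proof -
  obtain K where K: "0 \<le> K" "\<And>s y. s \<in> {min a t..max a t} \<Longrightarrow> norm (A s *v y) \<le> K * norm y"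
    using matrix_vector_bound_on_compact [OF _ continuous_on_subset [OF A subset_UNIV],
        of "{min a t..max a t}"]
    by auto
  \<comment> \<open>One family serves both directions of time: \<open>c = - K\<close> to the right
    of \<open>a\<close> and \<open>c = K\<close> to the left.\<close>
  define E where "E = (\<lambda>c s. exp (2 * c * conformable_time \<alpha> s) * (x s \<bullet> x s))"
  define E' where "E' = (\<lambda>c s. 2 * \<bar>s\<bar> powr (\<alpha> - 1) * exp (2 * c * conformable_time \<alpha> s)
      * (c * (x s \<bullet> x s) + x s \<bullet> (A s *v x s)))"
  have ftc: "(E' c has_integral E c v - E c u) {u..v}" if "u \<le> v" for c u v
  proof (rule fundamental_theorem_of_calculus_interior_strong [of "{0}"])
    show "continuous_on {u..v} (E c)"
      unfolding E_def
      by (intro continuous_intros continuous_on_conformable_time \<alpha> continuous_on_subset [OF x]) auto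
    show "(E c has_vector_derivative E' c s) (at s)" if "s \<in> {u<..<v} - {0}" for s
    proof -
      have s: "s \<noteq> 0"
        using that by auto
      have "((\<lambda>s. x s \<bullet> x s) has_vector_derivative
          2 * \<bar>s\<bar> powr (\<alpha> - 1) * (x s \<bullet> (A s *v x s))) (at s)"
        using bounded_bilinear.has_vector_derivative
          [OF bounded_bilinear_inner deriv [OF s] deriv [OF s]]
        by (simp add: inner_commute algebra_simps)
      then have sq: "((\<lambda>s. x s \<bullet> x s) has_real_derivative
          2 * \<bar>s\<bar> powr (\<alpha> - 1) * (x s \<bullet> (A s *v x s))) (at s)"
        by (simp add: has_real_derivative_iff_has_vector_derivative)
      have time: "(conformable_time \<alpha> has_real_derivative \<bar>s\<bar> powr (\<alpha> - 1)) (at s)"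
        using conformable_time_has_vector_derivative [OF \<alpha> s]
        by (simp add: has_real_derivative_iff_has_vector_derivative)
      show ?thesis
        unfolding E_def E'_def has_real_derivative_iff_has_vector_derivative [symmetric]
        by (rule derivative_eq_intros sq time refl)+ (simp add: algebra_simps)
    qed
  qed (use that in auto)
  \<comment> \<open>By this bound the last factor of \<open>E' c\<close> is nonpositive for
    \<open>c = - K\<close> and nonnegative for \<open>c = K\<close>.\<close>
  have cs: "\<bar>x s \<bullet> (A s *v x s)\<bar> \<le> K * (x s \<bullet> x s)" if "s \<in> {min a t..max a t}" for s
  proof -
    have "\<bar>x s \<bullet> (A s *v x s)\<bar> \<le> norm (x s) * (K * norm (x s))"
      by (rule order_trans [OF Cauchy_Schwarz_ineq2 mult_left_mono]) (use K(2) that in auto)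
    then show ?thesis
      by (simp add: power2_norm_eq_inner [symmetric] power2_eq_square mult_ac)
  qed
  have Ea: "E c a = 0" for c
    using zero by (simp add: E_def)
  have "\<exists>c. E c t \<le> 0"
  proof (cases "a \<le> t")
    case True
    have "E' (- K) s \<le> 0" if "s \<in> {a..t}" for s
      using cs [of s] that True unfolding E'_def by (intro mult_nonneg_nonpos) auto
    then have "0 \<le> - (E (- K) t - E (- K) a)"
      by (intro has_integral_nonneg [OF has_integral_neg [OF ftc [OF True]]]) auto
    then show ?thesis
      using Ea by auto
  next
    case False
    have "0 \<le> E' K s" if "s \<in> {t..a}" for s
      using cs [of s] that False unfolding E'_def by (intro mult_nonneg_nonneg) auto
    then have "0 \<le> E K a - E K t"
      using False by (intro has_integral_nonneg [OF ftc]) auto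
    then show ?thesis
      using Ea by auto
  qed
  \<comment> \<open>The exponential factor is positive, so \<open>E c t \<le> 0\<close> forces the
    inner product \<open>x t \<bullet> x t\<close> to vanish.\<close>
  then show "x t = 0"
    by (auto simp: E_def mult_le_0_iff) (metis inner_gt_zero_iff not_le)
qed

section \<open>Fundamental matrices and variation of constants\<close>

lemma matrix_vector_mult_sum_columns:
  fixes A :: "real^'n^'m"
  shows "A *v x = (\<Sum>j\<in>UNIV. x $ j *\<^sub>R column j A)"
  by (simp add: matrix_mult_sum scalar_mult_eq_scaleR)

context
  fixes \<alpha> :: real and A X :: "real \<Rightarrow> real^'n^'n"
  assumes \<alpha>: "0 < \<alpha>" and A: "continuous_on UNIV A" and X: "fundamental_matrix \<alpha> A X"
begin

lemma column_solution:
  "continuous_on UNIV (\<lambda>t. column j (X t))"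
  "t \<noteq> 0 \<Longrightarrow> ((\<lambda>t. column j (X t)) has_vector_derivative
    (\<bar>t\<bar> powr (\<alpha> - 1) *\<^sub>R (A t *v column j (X t)))) (at t)"
proof -
  have "conformable_solution \<alpha> (\<lambda>t y. A t *v y) (\<lambda>t. column j (X t))"
    using X by (simp add: fundamental_matrix_def)
  then have "continuous_on UNIV (\<lambda>t. column j (X t)) \<and> (\<forall>t. t \<noteq> 0 \<longrightarrow>
      ((\<lambda>t. column j (X t)) has_vector_derivative
        (\<bar>t\<bar> powr (\<alpha> - 1) *\<^sub>R (A t *v column j (X t)))) (at t))"
    by (subst (asm) conformable_solution_iff)
      (auto intro: bounded_bilinear.continuous_on [OF bounded_bilinear_matrix_vector_mult A])
  then show "continuous_on UNIV (\<lambda>t. column j (X t))"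
    "t \<noteq> 0 \<Longrightarrow> ((\<lambda>t. column j (X t)) has_vector_derivative
      (\<bar>t\<bar> powr (\<alpha> - 1) *\<^sub>R (A t *v column j (X t)))) (at t)"
    by auto
qed

lemma fundamental_matrix_continuous: "continuous_on UNIV X"
proof -
  have "continuous_on UNIV (\<lambda>t. \<chi> i j. column j (X t) $ i)"
    by (intro continuous_on_vec_lambda continuous_on_component column_solution(1))
  then show ?thesis
    by (simp add: column_def)
qed

text \<open>A product rule taken column by column: the coefficients are the components of
  \<open>u\<close>, and the columns are differentiable by the definition of a fundamental
  matrix.\<close>

lemma fundamental_matrix_mult_has_vector_derivative:
  assumes u: "(u has_vector_derivative u') (at t)" and t: "t \<noteq> 0"
  shows "((\<lambda>t. X t *v u t) has_vector_derivative
    (\<bar>t\<bar> powr (\<alpha> - 1) *\<^sub>R (A t *v (X t *v u t)) + X t *v u')) (at t)"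
proof -
  have uj: "((\<lambda>t. u t $ j) has_vector_derivative u' $ j) (at t)" for j
    using bounded_linear.has_vector_derivative [OF bounded_linear_vec_nth u] .
  have "((\<lambda>t. \<Sum>j\<in>UNIV. u t $ j *\<^sub>R column j (X t)) has_vector_derivative
      (\<Sum>j\<in>UNIV. u t $ j *\<^sub>R \<bar>t\<bar> powr (\<alpha> - 1) *\<^sub>R (A t *v column j (X t))
        + u' $ j *\<^sub>R column j (X t))) (at t)"
    by (intro has_vector_derivative_sum
        bounded_bilinear.has_vector_derivative [OF bounded_bilinear_scaleR] uj column_solution(2) t)
  also have "(\<Sum>j\<in>UNIV. u t $ j *\<^sub>R \<bar>t\<bar> powr (\<alpha> - 1) *\<^sub>R (A t *v column j (X t))
        + u' $ j *\<^sub>R column j (X t))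
      = \<bar>t\<bar> powr (\<alpha> - 1) *\<^sub>R (A t *v (X t *v u t)) + X t *v u'"
    by (simp add: matrix_vector_mult_sum_columns [of "X t"] sum.distrib scaleR_sum_right
        matrix_vector_mult_scaleR mult.commute
        linear_sum [OF matrix_vector_mul_linear, of "A t"])
  finally show ?thesis
    by (simp flip: matrix_vector_mult_sum_columns)
qed

text \<open>A kernel vector \<open>c\<close> of \<open>X t\<close> yields the solution
  \<open>X s *v c\<close>, which vanishes at \<open>t\<close> and hence everywhere by uniqueness;
  independence of the columns as functions then gives \<open>c = 0\<close>.\<close>

lemma fundamental_matrix_invertible: "invertible (X t)"
proof -
  have "c = 0" if c: "X t *v c = 0" for c
  proof -
    have "X s *v c = 0" for s
    proof (rule homogeneous_solution_unique [where x = "\<lambda>t. X t *v c", OF \<alpha> A])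
      show "continuous_on UNIV (\<lambda>t. X t *v c)"
        by (intro bounded_bilinear.continuous_on [OF bounded_bilinear_matrix_vector_mult]
            fundamental_matrix_continuous continuous_on_const)
      show "((\<lambda>t. X t *v c) has_vector_derivative
          \<bar>s\<bar> powr (\<alpha> - 1) *\<^sub>R (A s *v (X s *v c))) (at s)" if "s \<noteq> 0" for s
        using fundamental_matrix_mult_has_vector_derivative
          [where u = "\<lambda>t. c", OF has_vector_derivative_const that]
        by simp
      show "X t *v c = 0"
        by (rule c)
    qed
    then show "c = 0"
      using X by (simp add: fundamental_matrix_def matrix_vector_mult_sum_columns vec_eq_iff)
  qed
  then show ?thesis
    by (simp add: invertible_left_inverse matrix_left_invertible_ker)
qed

lemma variation_of_constants:
  fixes f :: "real \<Rightarrow> real^'n"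
  assumes f: "continuous_on UNIV f"
  shows "interval_lebesgue_integrable lborel (ereal a) (ereal b)
      (\<lambda>s. \<bar>s\<bar> powr (\<alpha> - 1) *\<^sub>R (matrix_inv (X s) *v f s))"
    and "conformable_solution \<alpha> (\<lambda>t y. A t *v y + f t) x \<and> x t0 = x0 \<longleftrightarrow>
      (\<forall>t. x t = (X t ** matrix_inv (X t0)) *v x0 +
        X t *v (LBINT s=ereal t0..ereal t. \<bar>s\<bar> powr (\<alpha> - 1) *\<^sub>R (matrix_inv (X s) *v f s)))"
proof -
  let ?g = "\<lambda>s. matrix_inv (X s) *v f s"
  let ?w = "\<lambda>t. \<bar>t\<bar> powr (\<alpha> - 1)"
  have g: "continuous_on UNIV ?g"
    by (intro continuous_on_matrix_inv_mult_vector fundamental_matrix_continuous f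
        fundamental_matrix_invertible)
  show "interval_lebesgue_integrable lborel (ereal a) (ereal b) (\<lambda>s. ?w s *\<^sub>R ?g s)"
    by (rule weight_interval_integrable [OF \<alpha> g])
  define U where "U = (\<lambda>t. LBINT s=ereal t0..ereal t. ?w s *\<^sub>R ?g s)"
  \<comment> \<open>The ansatz \<open>X t *v u t\<close> with \<open>u\<close> varying:
    \<open>u t0\<close> is fixed by the initial value, and \<open>u'\<close> must be the weighted
    \<open>matrix_inv (X t) *v f t\<close>.\<close>
  define z where "z = (\<lambda>t. X t *v (matrix_inv (X t0) *v x0 + U t))"
  note U = weight_interval_integral [where a = t0, OF \<alpha> g, folded U_def]
  note inv = matrix_inv_both(1) [OF fundamental_matrix_invertible]
  have solution_iff: "conformable_solution \<alpha> (\<lambda>t y. A t *v y + f t) y \<longleftrightarrow> continuous_on UNIV y \<and>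
      (\<forall>t. t \<noteq> 0 \<longrightarrow> (y has_vector_derivative (?w t *\<^sub>R (A t *v y t + f t))) (at t))" for y
    by (rule conformable_solution_iff)
      (intro continuous_intros bounded_bilinear.continuous_on
        [OF bounded_bilinear_matrix_vector_mult A] f)
  have z_cont: "continuous_on UNIV z"
    unfolding z_def
    by (intro bounded_bilinear.continuous_on [OF bounded_bilinear_matrix_vector_mult]
        fundamental_matrix_continuous continuous_intros U(1))
  have z_deriv: "(z has_vector_derivative (?w t *\<^sub>R (A t *v z t + f t))) (at t)"
    if t: "t \<noteq> 0" for t
  proof -
    have "((\<lambda>t. matrix_inv (X t0) *v x0 + U t) has_vector_derivative ?w t *\<^sub>R ?g t) (at t)"
      using has_vector_derivative_add [OF has_vector_derivative_const U(2) [OF t]] by simp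
    from fundamental_matrix_mult_has_vector_derivative
      [where u = "\<lambda>t. matrix_inv (X t0) *v x0 + U t", OF this t]
    show ?thesis
      by (simp add: z_def matrix_vector_mult_scaleR matrix_vector_mul_assoc inv scaleR_add_right)
  qed
  have z0: "z t0 = x0"
    by (simp add: z_def U_def matrix_vector_mul_assoc inv)
  have "conformable_solution \<alpha> (\<lambda>t y. A t *v y + f t) x \<and> x t0 = x0 \<longleftrightarrow> (\<forall>t. x t = z t)"
  proof
    assume "\<forall>t. x t = z t"
    then have "x = z"
      by auto
    then show "conformable_solution \<alpha> (\<lambda>t y. A t *v y + f t) x \<and> x t0 = x0"
      using z_cont z_deriv z0 by (simp add: solution_iff)
  next
    assume "conformable_solution \<alpha> (\<lambda>t y. A t *v y + f t) x \<and> x t0 = x0"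
    then have x: "continuous_on UNIV x" "x t0 = x0"
      "\<And>t. t \<noteq> 0 \<Longrightarrow> (x has_vector_derivative (?w t *\<^sub>R (A t *v x t + f t))) (at t)"
      by (auto simp: solution_iff)
    \<comment> \<open>The forcing term cancels in the difference, which solves the homogeneous
      equation and vanishes at \<open>t0\<close>.\<close>
    have "x t - z t = 0" for t
    proof (rule homogeneous_solution_unique [where x = "\<lambda>t. x t - z t", OF \<alpha> A])
      show "continuous_on UNIV (\<lambda>t. x t - z t)"
        by (intro continuous_intros x(1) z_cont)
      show "((\<lambda>t. x t - z t) has_vector_derivative ?w t *\<^sub>R (A t *v (x t - z t))) (at t)"
        if "t \<noteq> 0" for t
        using has_vector_derivative_diff [OF x(3) z_deriv, OF that that]
        by (simp add: matrix_vector_mult_diff_distrib algebra_simps)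
      show "x t0 - z t0 = 0"
        using x(2) z0 by simp
    qed
    then show "\<forall>t. x t = z t"
      by simp
  qed
  then show "conformable_solution \<alpha> (\<lambda>t y. A t *v y + f t) x \<and> x t0 = x0 \<longleftrightarrow>
      (\<forall>t. x t = (X t ** matrix_inv (X t0)) *v x0 +
        X t *v (LBINT s=ereal t0..ereal t. ?w s *\<^sub>R ?g s))"
    by (simp add: z_def U_def matrix_vector_right_distrib matrix_vector_mul_assoc)
qed

end

section \<open>The matrix exponential series\<close>

lemma bounded_bilinear_matrix_matrix_mult:
  "bounded_bilinear ((**) :: real^'n^'m \<Rightarrow> real^'k^'n \<Rightarrow> real^'k^'m)"
  unfolding bilinear_conv_bounded_bilinear [symmetric] bilinear_def linear_iff
  by (auto simp: matrix_matrix_mult_def vec_eq_iff sum.distrib distrib_left distrib_right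
      sum_distrib_left mult_ac)

lemma matrix_power_uminus: "matrix_power (- M) k = (- 1) ^ k *\<^sub>R matrix_power M k"
  by (induction k)
    (simp_all add: bounded_bilinear.minus_left [OF bounded_bilinear_matrix_matrix_mult]
      bounded_bilinear.scaleR_right [OF bounded_bilinear_matrix_matrix_mult])

text \<open>Boundedness of the product gives submultiplicativity up to a factor \<open>K\<close>, so
  \<open>L = norm M * K\<close> works; \<open>norm (mat 1)\<close> accounts for
  \<open>k = 0\<close>.\<close>

lemma matrix_power_norm_bound:
  fixes M :: "real^'n^'n"
  obtains L where "\<And>k. norm (matrix_power M k) \<le> norm (mat 1 :: real^'n^'n) * L ^ k"
proof -
  obtain K where K: "K > 0" "\<And>A B. norm ((A::real^'n^'n) ** (B::real^'n^'n)) \<le> norm A * norm B * K"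
    using bounded_bilinear.pos_bounded [OF bounded_bilinear_matrix_matrix_mult] by blast
  have "norm (matrix_power M k) \<le> norm (mat 1 :: real^'n^'n) * (norm M * K) ^ k" for k
  proof (induction k)
    case (Suc k)
    have "norm (matrix_power M (Suc k)) \<le> norm M * norm (matrix_power M k) * K"
      using K(2) by simp
    also have "\<dots> \<le> norm M * (norm (mat 1 :: real^'n^'n) * (norm M * K) ^ k) * K"
      using K(1) Suc by (intro mult_right_mono mult_left_mono) auto
    finally show ?case
      by (simp add: mult_ac)
  qed simp
  then show thesis
    by (rule that)
qed

lemma matrix_exp_series_summable:
  fixes M :: "real^'n^'n"
  shows "summable (\<lambda>k. (s ^ k / fact k) *\<^sub>R matrix_power M k)"
proof -
  obtain L where L: "\<And>k. norm (matrix_power M k) \<le> norm (mat 1 :: real^'n^'n) * L ^ k"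
    using matrix_power_norm_bound by blast
  \<comment> \<open>The majorant is the scalar exponential series at
    \<open>\<bar>s\<bar> * L\<close>, up to a constant factor.\<close>
  have "summable (\<lambda>k. norm (mat 1 :: real^'n^'n) * ((\<bar>s\<bar> * L) ^ k /\<^sub>R fact k))"
    by (intro summable_mult summable_exp_generic)
  then show ?thesis
  proof (rule summable_comparison_test')
    fix k :: nat
    have "norm ((s ^ k / fact k) *\<^sub>R matrix_power M k)
        = \<bar>s\<bar> ^ k / fact k * norm (matrix_power M k)"
      by (simp add: power_abs)
    also have "\<dots> \<le> \<bar>s\<bar> ^ k / fact k * (norm (mat 1 :: real^'n^'n) * L ^ k)"
      by (intro mult_left_mono L) auto
    finally show "norm ((s ^ k / fact k) *\<^sub>R matrix_power M k)
        \<le> norm (mat 1 :: real^'n^'n) * ((\<bar>s\<bar> * L) ^ k /\<^sub>R fact k)"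
      by (simp add: field_simps power_mult_distrib)
  qed
qed

text \<open>This is the exponential of \<open>s\<close> times \<open>M\<close>; keeping the scalar
  apart makes each entry a power series in \<open>s\<close>.\<close>

definition matrix_exp :: "real^'n^'n \<Rightarrow> real \<Rightarrow> real^'n^'n" where
  "matrix_exp M s = (\<Sum>k. (s ^ k / fact k) *\<^sub>R matrix_power M k)"

lemma matrix_exp_0: "matrix_exp M 0 = mat 1"
proof -
  have "(\<Sum>k. (0 ^ k / fact k) *\<^sub>R matrix_power M k)
      = (\<Sum>k\<in>{0}. (0 ^ k / fact k) *\<^sub>R matrix_power M k)"
    by (rule suminf_finite) auto
  then show ?thesis
    by (simp add: matrix_exp_def)
qed

text \<open>Each entry is an everywhere convergent real power series and may be differentiated term
  by term.\<close>

lemma matrix_exp_entry_has_vector_derivative: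
  fixes M :: "real^'n^'n"
  shows "((\<lambda>s. matrix_exp M s $ i $ j) has_vector_derivative (M ** matrix_exp M s) $ i $ j) (at s)"
proof -
  define c where "c = (\<lambda>k. matrix_power M k $ i $ j / fact k)"
  have entry: "bounded_linear (\<lambda>A::real^'n^'n. A $ i $ j)"
    by (intro bounded_linear_compose [OF bounded_linear_vec_nth bounded_linear_vec_nth])
  have sums: "(\<lambda>k. c k * s ^ k) sums (matrix_exp M s $ i $ j)" for s
    using bounded_linear.sums [OF entry summable_sums [OF matrix_exp_series_summable]]
    by (simp add: c_def matrix_exp_def mult_ac)
  have "(\<lambda>k. (M ** ((s ^ k / fact k) *\<^sub>R matrix_power M k)) $ i $ j) sums
      ((M ** matrix_exp M s) $ i $ j)"
    unfolding matrix_exp_def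
    by (intro bounded_linear.sums [OF entry] summable_sums [OF matrix_exp_series_summable]
        bounded_linear.sums [OF
          bounded_bilinear.bounded_linear_right [OF bounded_bilinear_matrix_matrix_mult]])
  \<comment> \<open>The factor \<open>Suc k\<close> from differentiation cancels against
    \<open>fact (Suc k)\<close>, and the shifted power splits off one \<open>M\<close> on the
    left.\<close>
  moreover have "diffs c k = (M ** matrix_power M k) $ i $ j / fact k" for k
    by (simp add: diffs_def c_def del: of_nat_Suc)
  then have "(M ** ((s ^ k / fact k) *\<^sub>R matrix_power M k)) $ i $ j = diffs c k * s ^ k" for k
    by (simp add: bounded_bilinear.scaleR_right [OF bounded_bilinear_matrix_matrix_mult])
  ultimately have "(\<Sum>k. diffs c k * s ^ k) = (M ** matrix_exp M s) $ i $ j"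
    by (simp add: sums_iff)
  then show ?thesis
    using termdiffs_strong_converges_everywhere [of c s] sums
    by (simp add: sums_iff has_real_derivative_iff_has_vector_derivative)
qed

text \<open>This lifts the derivatives of entries to derivatives of columns.\<close>

lemma column_sum_axis:
  fixes A :: "real^'n^'m"
  shows "column j A = (\<Sum>i\<in>UNIV. A $ i $ j *\<^sub>R axis i 1)"
  using basis_expansion [of "column j A"] by (simp add: scalar_mult_eq_scaleR column_def)

lemma column_matrix_matrix_mult: "column j (A ** B) = A *v column j B"
  by (simp add: column_def matrix_matrix_mult_def matrix_vector_mult_def vec_eq_iff)

lemma matrix_exp_column_has_vector_derivative:
  fixes M :: "real^'n^'n"
  shows "((\<lambda>s. column j (matrix_exp M s)) has_vector_derivative
    M *v column j (matrix_exp M s)) (at s)"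
proof -
  have "((\<lambda>s. \<Sum>i\<in>UNIV. matrix_exp M s $ i $ j *\<^sub>R axis i 1) has_vector_derivative
      (\<Sum>i\<in>UNIV. (M ** matrix_exp M s) $ i $ j *\<^sub>R (axis i 1 :: real^'n))) (at s)"
    by (intro has_vector_derivative_sum
        bounded_linear.has_vector_derivative [OF bounded_linear_scaleR_left]
        matrix_exp_entry_has_vector_derivative)
  then show ?thesis
    by (simp flip: column_sum_axis column_matrix_matrix_mult)
qed

section \<open>The conformable exponential as a fundamental matrix\<close>

text \<open>For \<open>t < 0\<close> the signs of the powers of \<open>- M\<close> move into the
  scalar, where they match the negative conformable time; both branches thus become one
  series.\<close>

lemma conformable_exp_eq_matrix_exp:
  assumes "0 < \<alpha>"
  shows "conformable_exp \<alpha> M t = matrix_exp M (conformable_time \<alpha> t)"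
proof (cases "0 \<le> t")
  case True
  then have "conformable_time \<alpha> t = t powr \<alpha> / \<alpha>"
    by (simp add: conformable_time_def sgn_if)
  then show ?thesis
    using True by (simp add: conformable_exp_def matrix_exp_def power_divide)
next
  case False
  then have "conformable_time \<alpha> t = - 1 * ((- t) powr \<alpha> / \<alpha>)"
    by (simp add: conformable_time_def)
  then have "conformable_time \<alpha> t ^ k = (- 1) ^ k * (((- t) powr \<alpha>) ^ k / \<alpha> ^ k)" for k
    by (simp only: power_mult_distrib power_divide)
  then show ?thesis
    using False by (simp add: conformable_exp_def matrix_exp_def matrix_power_uminus mult_ac)
qed

text \<open>The chain rule supplies the weight as the derivative of conformable time. Independence
  of the columns is read off at \<open>t = 0\<close>, where the matrix is the identity.\<close>

lemma fundamental_matrix_conformable_exp: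
  fixes M :: "real^'n^'n"
  assumes \<alpha>: "0 < \<alpha>"
  shows "fundamental_matrix \<alpha> (\<lambda>_. M) (conformable_exp \<alpha> M)"
proof -
  have "conformable_solution \<alpha> (\<lambda>t y. M *v y) (\<lambda>t. column j (conformable_exp \<alpha> M t))" for j
  proof (subst conformable_solution_iff)
    show "continuous_on UNIV x \<Longrightarrow> continuous_on UNIV (\<lambda>t. M *v x t)" for x
      by (intro bounded_linear.continuous_on [OF matrix_vector_mul_bounded_linear])
    have "continuous_on UNIV (\<lambda>s. column j (matrix_exp M s))"
      by (intro continuous_at_imp_continuous_on ballI
          has_vector_derivative_continuous [OF matrix_exp_column_has_vector_derivative])
    then have "continuous_on UNIV (\<lambda>t. column j (matrix_exp M (conformable_time \<alpha> t)))"
      by (rule continuous_on_compose2 [OF _ continuous_on_conformable_time [OF \<alpha>]]) auto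
    moreover have "((\<lambda>t. column j (matrix_exp M (conformable_time \<alpha> t))) has_vector_derivative
        \<bar>t\<bar> powr (\<alpha> - 1) *\<^sub>R (M *v column j (matrix_exp M (conformable_time \<alpha> t)))) (at t)"
      if "t \<noteq> 0" for t
      using vector_diff_chain_at [OF conformable_time_has_vector_derivative [OF \<alpha> that]
          matrix_exp_column_has_vector_derivative]
      by (simp add: o_def)
    ultimately show "continuous_on UNIV (\<lambda>t. column j (conformable_exp \<alpha> M t)) \<and>
        (\<forall>t. t \<noteq> 0 \<longrightarrow> ((\<lambda>t. column j (conformable_exp \<alpha> M t)) has_vector_derivative
          \<bar>t\<bar> powr (\<alpha> - 1) *\<^sub>R (M *v column j (conformable_exp \<alpha> M t))) (at t))"
      by (simp add: conformable_exp_eq_matrix_exp [OF \<alpha>])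
  qed
  moreover have "c j = 0"
    if "\<forall>t. (\<Sum>j\<in>UNIV. c j *\<^sub>R column j (conformable_exp \<alpha> M t)) = 0" for c :: "'n \<Rightarrow> real" and j
  proof -
    have "conformable_exp \<alpha> M 0 = mat 1"
      by (simp add: conformable_exp_eq_matrix_exp [OF \<alpha>] conformable_time_def matrix_exp_0)
    moreover have "conformable_exp \<alpha> M 0 *v (\<chi> j. c j) = 0"
      using that by (simp add: matrix_vector_mult_sum_columns)
    ultimately have "(\<chi> j. c j) = 0"
      by simp
    then show ?thesis
      by (simp add: vec_eq_iff)
  qed
  ultimately show ?thesis
    by (simp add: fundamental_matrix_def)
qed

text \<open>Invertibility and integrability are asserted alongside the formula because
  \<open>matrix_inv\<close> and the integral are total functions; they ensure that the formula has
  its intended meaning. The equivalence contains both existence and uniqueness.\<close>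

theorem theorem2p2:
  fixes \<alpha> :: real
    and A :: "real \<Rightarrow> real^'n^'n"
    and f :: "real \<Rightarrow> real^'n"
    and t0 :: real
    and x0 :: "real^'n"
  assumes "0 < \<alpha>" and "\<alpha> \<le> 1"
    and "continuous_on UNIV A"
    and "continuous_on UNIV f"
  shows "(\<forall>X. fundamental_matrix \<alpha> A X \<longrightarrow>
      (\<forall>t. invertible (X t)) \<and>
      (\<forall>t. interval_lebesgue_integrable lborel (ereal t0) (ereal t)
             (\<lambda>s. \<bar>s\<bar> powr (\<alpha> - 1) *\<^sub>R (matrix_inv (X s) *v f s))) \<and>
      (\<forall>x. conformable_solution \<alpha> (\<lambda>t y. A t *v y + f t) x \<and> x t0 = x0 \<longleftrightarrow>
         (\<forall>t. x t = (X t ** matrix_inv (X t0)) *v x0 +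
            X t *v (LBINT s=ereal t0..ereal t.
                      \<bar>s\<bar> powr (\<alpha> - 1) *\<^sub>R (matrix_inv (X s) *v f s)))))
    \<and> (\<forall>M. (\<forall>t. A t = M) \<longrightarrow>
      (\<forall>t. invertible (conformable_exp \<alpha> M t)) \<and>
      (\<forall>t. interval_lebesgue_integrable lborel (ereal t0) (ereal t)
             (\<lambda>s. \<bar>s\<bar> powr (\<alpha> - 1) *\<^sub>R (matrix_inv (conformable_exp \<alpha> M s) *v f s))) \<and>
      (\<forall>x. conformable_solution \<alpha> (\<lambda>t y. A t *v y + f t) x \<and> x t0 = x0 \<longleftrightarrow>
         (\<forall>t. x t = (conformable_exp \<alpha> M t ** matrix_inv (conformable_exp \<alpha> M t0)) *v x0 +
            conformable_exp \<alpha> M t *v (LBINT s=ereal t0..ereal t.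
                      \<bar>s\<bar> powr (\<alpha> - 1) *\<^sub>R (matrix_inv (conformable_exp \<alpha> M s) *v f s)))))"
    (is "(\<forall>X. fundamental_matrix \<alpha> A X \<longrightarrow> ?P X) \<and> (\<forall>M. (\<forall>t. A t = M) \<longrightarrow> ?P (conformable_exp \<alpha> M))")
proof (rule conjI)
  show general: "\<forall>X. fundamental_matrix \<alpha> A X \<longrightarrow> ?P X"
  proof (intro allI impI)
    fix X
    assume X: "fundamental_matrix \<alpha> A X"
    note hyps = assms(1,3) X
    show "?P X"
      using fundamental_matrix_invertible [OF hyps]
        variation_of_constants [OF hyps assms(4)] by blast
  qed
  show "\<forall>M. (\<forall>t. A t = M) \<longrightarrow> ?P (conformable_exp \<alpha> M)"
  proof (intro allI impI)
    fix M
    assume "\<forall>t. A t = M"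
    then have "A = (\<lambda>_. M)"
      by auto
    then have "fundamental_matrix \<alpha> A (conformable_exp \<alpha> M)"
      using fundamental_matrix_conformable_exp [OF assms(1)] by simp
    then show "?P (conformable_exp \<alpha> M)"
      by (rule general [rule_format])
  qed
qed

end
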